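(* Let $k\ge 1$ and let $\boldsymbol{Y}=(Y_1,\ldots,Y_k)^\top$ be a positive continuous random vector on $(0,\infty)^k$ such that $\mathbb{E}(Y_{\ell_1}Y_{\ell_2})<\infty$ for all $\ell_1,\ell_2\in\{1,\ldots,k\}$. Let $\boldsymbol{Y}_1,\boldsymbol{Y}_2,\ldots$ be independent random vectors with the same distribution as $\boldsymbol{Y}$, and for each $n\ge 2$ let $\widehat{\mathrm{GVI}}_n(\boldsymbol{Y})$ and $\widehat{\mathrm{MVI}}_n(\boldsymbol{Y})$ be the empirical generalized and multiple marginal variation indexes computed from the random sample $\boldsymbol{Y}_1,\ldots,\boldsymbol{Y}_n$. Then, as $n\to\infty$, $$\widehat{\mathrm{GVI}}_n(\boldsymbol{Y})\longrightarrow \mathrm{GVI}(\boldsymbol{Y})\ \text{ almost surely}\quad\text{and}\quad \widehat{\mathrm{MVI}}_n(\boldsymbol{Y})\longrightarrow \mathrm{MVI}(\boldsymbol{Y})\ \text{ almost surely}.$$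
   Context: For a random vector $\boldsymbol{Y}=(Y_1,\ldots,Y_k)^\top$ with values in $(0,\infty)^k$, with mean vector $\mathbb{E}\boldsymbol{Y}$ and covariance matrix $\mathrm{cov}\,\boldsymbol{Y}=(\mathrm{cov}(Y_i,Y_j))_{i,j}$, the generalized variation index and the multiple marginal variation index are the real numbers $$\mathrm{GVI}(\boldsymbol{Y})=\frac{(\mathbb{E}\boldsymbol{Y})^\top(\mathrm{cov}\,\boldsymbol{Y})\,\mathbb{E}\boldsymbol{Y}}{\big((\mathbb{E}\boldsymbol{Y})^\top\mathbb{E}\boldsymbol{Y}\big)^2},\qquad \mathrm{MVI}(\boldsymbol{Y})=\frac{(\mathbb{E}\boldsymbol{Y})^\top(\mathrm{diag}\,\mathrm{var}\,\boldsymbol{Y})\,\mathbb{E}\boldsymbol{Y}}{\big((\mathbb{E}\boldsymbol{Y})^\top\mathbb{E}\boldsymbol{Y}\big)^2},$$ where $\mathrm{diag}\,\mathrm{var}\,\boldsymbol{Y}$ is the $k\times k$ diagonal matrix with diagonal entries $\mathrm{var}\,Y_1,\ldots,\mathrm{var}\,Y_k$. Given a random sample $\boldsymbol{Y}_1,\ldots,\boldsymbol{Y}_n$ ($n\ge 2$) from $\boldsymbol{Y}$, set $$\overline{\boldsymbol{Y}}_n=\frac1n\sum_{i=1}^n\boldsymbol{Y}_i,\qquad \widehat{\mathrm{cov}\boldsymbol{Y}}=\frac{1}{n-1}\sum_{i=1}^n\boldsymbol{Y}_i\boldsymbol{Y}_i^\top-\overline{\boldsymbol{Y}}_n\overline{\boldsymbol{Y}}_n^\top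 .$$ The empirical indexes are the plug-in estimators $$\widehat{\mathrm{GVI}}_n(\boldsymbol{Y})=\frac{\overline{\boldsymbol{Y}}_n^\top\,\widehat{\mathrm{cov}\boldsymbol{Y}}\,\overline{\boldsymbol{Y}}_n}{(\overline{\boldsymbol{Y}}_n^\top\overline{\boldsymbol{Y}}_n)^2},\qquad \widehat{\mathrm{MVI}}_n(\boldsymbol{Y})=\frac{\overline{\boldsymbol{Y}}_n^\top\,\widehat{D}_n\,\overline{\boldsymbol{Y}}_n}{(\overline{\boldsymbol{Y}}_n^\top\overline{\boldsymbol{Y}}_n)^2},$$ where $\widehat{D}_n$ is the diagonal matrix having the same diagonal entries as $\widehat{\mathrm{cov}\boldsymbol{Y}}$. *)

theory Defs
  imports "HOL-Probability.Probability"
begin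

definition diag_matrix :: "real ^ 'k \<Rightarrow> real ^ 'k ^ 'k"
  where "diag_matrix v = (\<chi> i j. if i = j then v $ i else 0)"

definition cov_matrix :: "'a measure \<Rightarrow> ('a \<Rightarrow> real ^ 'k) \<Rightarrow> real ^ 'k ^ 'k"
  where "cov_matrix M Y = (\<chi> i j. prob_space.expectation M (\<lambda>\<omega>.
    (Y \<omega> $ i - prob_space.expectation M (\<lambda>\<omega>. Y \<omega> $ i)) *
    (Y \<omega> $ j - prob_space.expectation M (\<lambda>\<omega>. Y \<omega> $ j))))"

definition var_vector :: "'a measure \<Rightarrow> ('a \<Rightarrow> real ^ 'k) \<Rightarrow> real ^ 'k"
  where "var_vector M Y = (\<chi> i. prob_space.variance M (\<lambda>\<omega>. Y \<omega> $ i))"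

definition GVI :: "'a measure \<Rightarrow> ('a \<Rightarrow> real ^ 'k) \<Rightarrow> real"
  where "GVI M Y = (let m = prob_space.expectation M Y in
    (m \<bullet> (cov_matrix M Y *v m)) / (m \<bullet> m)\<^sup>2)"

definition MVI :: "'a measure \<Rightarrow> ('a \<Rightarrow> real ^ 'k) \<Rightarrow> real"
  where "MVI M Y = (let m = prob_space.expectation M Y in
    (m \<bullet> (diag_matrix (var_vector M Y) *v m)) / (m \<bullet> m)\<^sup>2)"

text \<open>The estimators act on a realized sample \<open>y 1, \<dots>, y n\<close>.\<close>

definition sample_mean :: "nat \<Rightarrow> (nat \<Rightarrow> real ^ 'k) \<Rightarrow> real ^ 'k"
  where "sample_mean n y = (1 / real n) *\<^sub>R (\<Sum>i=1..n. y i)"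

definition outer_product :: "real ^ 'k \<Rightarrow> real ^ 'k \<Rightarrow> real ^ 'k ^ 'k"
  where "outer_product u v = (\<chi> i j. u $ i * v $ j)"

text \<open>The factor \<open>1 / (n - 1)\<close> applies only to the sum of the outer products, so for finite \<open>n\<close>
  this is not the usual unbiased sample covariance.\<close>

definition sample_cov :: "nat \<Rightarrow> (nat \<Rightarrow> real ^ 'k) \<Rightarrow> real ^ 'k ^ 'k"
  where "sample_cov n y =
    (1 / (real n - 1)) *\<^sub>R (\<Sum>i=1..n. outer_product (y i) (y i))
    - outer_product (sample_mean n y) (sample_mean n y)"

definition empirical_GVI :: "nat \<Rightarrow> (nat \<Rightarrow> real ^ 'k) \<Rightarrow> real"
  where "empirical_GVI n y = (let m = sample_mean n y in
    (m \<bullet> (sample_cov n y *v m)) / (m \<bullet> m)\<^sup>2)"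

definition empirical_MVI :: "nat \<Rightarrow> (nat \<Rightarrow> real ^ 'k) \<Rightarrow> real"
  where "empirical_MVI n y = (let m = sample_mean n y in
    (m \<bullet> (diag_matrix (\<chi> i. sample_cov n y $ i $ i) *v m)) / (m \<bullet> m)\<^sup>2)"

end

theory Submission
  imports Defs "HOL-Real_Asymp.Real_Asymp"
begin

text \<open>The empirical indexes are continuous functions of the sample means of the coordinates
  \<open>Y\<^sub>l\<close> and of the products \<open>Y\<^sub>l Y\<^sub>m\<close>, so the strong law of large numbers for integrable, identically
  distributed, pairwise independent variables suffices. It is proved by Etemadi's method. For
  nonnegative \<open>Z i\<close> and \<open>a > 1\<close>, truncate the first \<open>\<lceil>a ^ n\<rceil>\<close> variables at level \<open>a ^ n\<close>: both the
  probabilities that the truncation has an effect and the Chebyshev bounds for the truncated means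
  are summable in \<open>n\<close>, since they reduce to geometric sums bounded by a multiple of \<open>E Z\<close>.
  This gives convergence along \<open>\<lceil>a ^ n\<rceil>\<close>; monotonicity of the partial sums and \<open>a \<rightarrow> 1\<close> give the
  full sequence, and splitting into positive and negative parts removes the sign condition.\<close>

section \<open>Variances of sums and two geometric sum estimates\<close>

text \<open>The square of the sum expands into products of two of the variables, so pairwise
  independence is enough to make the off-diagonal covariances vanish.\<close>

lemma (in prob_space) variance_sum_pairwise_indep:
  fixes V :: "'i \<Rightarrow> 'a \<Rightarrow> real"
  assumes "finite I"
    and int: "\<And>i. i \<in> I \<Longrightarrow> integrable M (V i)"
    and int2: "\<And>i. i \<in> I \<Longrightarrow> integrable M (\<lambda>x. (V i x)\<^sup>2)"
    and indep: "\<And>i j. i \<in> I \<Longrightarrow> j \<in> I \<Longrightarrow> i \<noteq> j \<Longrightarrow> indep_var borel (V i) borel (V j)"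
  shows "integrable M (\<lambda>x. (\<Sum>i\<in>I. V i x)\<^sup>2)"
    and "variance (\<lambda>x. \<Sum>i\<in>I. V i x) = (\<Sum>i\<in>I. variance (V i))"
proof -
  have prod: "integrable M (\<lambda>x. V i x * V j x) \<and>
      expectation (\<lambda>x. V i x * V j x) =
        expectation (V i) * expectation (V j) + (if i = j then variance (V i) else 0)"
    if "i \<in> I" "j \<in> I" for i j
  proof (cases "i = j")
    case True
    then show ?thesis
      using variance_eq[OF int[OF that(1)] int2[OF that(1)]] int2[OF that(1)]
      by (simp add: power2_eq_square)
  next
    case False
    then show ?thesis
      using indep_var_lebesgue_integral[OF indep int int, of i j]
        indep_var_integrable[OF indep int int, of i j] that by simp
  qed
  have square: "(\<lambda>x. (\<Sum>i\<in>I. V i x)\<^sup>2) = (\<lambda>x. \<Sum>i\<in>I. \<Sum>j\<in>I. V i x * V j x)"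
    by (simp add: power2_eq_square sum_product)
  show *: "integrable M (\<lambda>x. (\<Sum>i\<in>I. V i x)\<^sup>2)"
    unfolding square using prod by (intro Bochner_Integration.integrable_sum) auto
  have E: "expectation (\<lambda>x. \<Sum>i\<in>I. V i x) = (\<Sum>i\<in>I. expectation (V i))"
    using int by (intro Bochner_Integration.integral_sum) auto
  have "expectation (\<lambda>x. (\<Sum>i\<in>I. V i x)\<^sup>2) = (\<Sum>i\<in>I. \<Sum>j\<in>I. expectation (\<lambda>x. V i x * V j x))"
    unfolding square using prod by (simp add: Bochner_Integration.integral_sum)
  also have "\<dots> =
      (\<Sum>i\<in>I. \<Sum>j\<in>I. expectation (V i) * expectation (V j) + (if i = j then variance (V i) else 0))"
    using prod by (intro sum.cong refl) auto
  also have "\<dots> = (\<Sum>i\<in>I. expectation (V i))\<^sup>2 + (\<Sum>i\<in>I. variance (V i))"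
    using \<open>finite I\<close> by (simp add: sum.distrib power2_eq_square sum_product)
  finally show "variance (\<lambda>x. \<Sum>i\<in>I. V i x) = (\<Sum>i\<in>I. variance (V i))"
    using int * E by (subst variance_eq) auto
qed

text \<open>Integrated at \<open>x = Z 0\<close>, this controls the tail probabilities of
  \<open>Z 0\<close> at the levels \<open>a ^ n\<close>, weighted by \<open>a ^ n\<close>. The
  nonzero terms begin a geometric series, whose sum is at most \<open>a / (a - 1)\<close> times the
  last term, and that term is below \<open>x\<close>.\<close>

lemma sum_powers_below:
  fixes a x :: real
  assumes "1 < a" "0 \<le> x"
  shows "(\<Sum>n<N. if a ^ n < x then a ^ n else 0) \<le> a / (a - 1) * x"
proof -
  \<comment> \<open>The first bound makes the induction close: adding the term \<open>a ^ N\<close>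
    turns it into \<open>a / (a - 1) * a ^ N\<close>, and \<open>a ^ N < x\<close> then yields the
    second.\<close>
  have "(\<Sum>n<N. if a ^ n < x then a ^ n else 0) \<le> a ^ N / (a - 1) \<and>
      (\<Sum>n<N. if a ^ n < x then a ^ n else 0) \<le> a / (a - 1) * x"
  proof (induction N)
    case 0
    then show ?case using assms by simp
  next
    case (Suc N)
    have step: "a ^ N / (a - 1) + a ^ N = a / (a - 1) * a ^ N"
      using assms by (simp add: divide_simps) (simp add: algebra_simps)
    have mono: "a ^ N / (a - 1) \<le> a / (a - 1) * a ^ N"
      using step assms by (smt (verit) zero_less_power)
    show ?case
    proof (cases "a ^ N < x")
      case True
      then have "a / (a - 1) * a ^ N \<le> a / (a - 1) * x"
        using assms by (intro mult_left_mono) auto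
      with True Suc step show ?thesis by simp
    next
      case False
      with Suc mono show ?thesis by simp
    qed
  qed
  then show ?thesis ..
qed

text \<open>The counterpart for truncated second moments. The nonzero terms belong to a tail of a
  geometric series with ratio \<open>1 / a\<close>, and the first of them is at most
  \<open>x\<close> because \<open>x \<le> a ^ n\<close>.\<close>

lemma sum_inverse_powers_above:
  fixes a x :: real
  assumes "1 < a" "0 \<le> x"
  shows "(\<Sum>n<N. if x \<le> a ^ n then x\<^sup>2 / a ^ n else 0) \<le> a / (a - 1) * x"
proof -
  define r where "r = a / (a - 1)"
  have r: "r > 0" "r / a = r - 1"
    using assms by (auto simp: r_def divide_simps)
  \<comment> \<open>The subtracted \<open>r * (x\<^sup>2 / a ^ N)\<close> is the sum of
    \<open>x\<^sup>2 / a ^ n\<close> over all \<open>n \<ge> N\<close>. Keeping it makes the bound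
    telescope once \<open>x \<le> a ^ N\<close>.\<close>
  have "(\<Sum>n<N. if x \<le> a ^ n then x\<^sup>2 / a ^ n else 0) \<le>
      (if x \<le> a ^ N then r * x - r * (x\<^sup>2 / a ^ N) else 0)"
  proof (induction N)
    case 0
    have "x\<^sup>2 \<le> x" if "x \<le> 1"
      using that assms by (simp add: power2_eq_square mult_left_le)
    then show ?case using r by simp
  next
    case (Suc N)
    have le: "a ^ N \<le> a ^ Suc N"
      using assms by (intro power_increasing) auto
    have eq: "r * (x\<^sup>2 / a ^ Suc N) = r * (x\<^sup>2 / a ^ N) - x\<^sup>2 / a ^ N"
    proof -
      have "r * (x\<^sup>2 / a ^ Suc N) = (r / a) * (x\<^sup>2 / a ^ N)" by simp
      also have "\<dots> = r * (x\<^sup>2 / a ^ N) - x\<^sup>2 / a ^ N"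
        unfolding r by (simp add: left_diff_distrib diff_divide_distrib)
      finally show ?thesis .
    qed
    show ?case
    proof (cases "x \<le> a ^ N")
      case True
      with le have "x \<le> a ^ Suc N" by linarith
      with True Suc have "(\<Sum>n<Suc N. if x \<le> a ^ n then x\<^sup>2 / a ^ n else 0) \<le> r * x - r * (x\<^sup>2 / a ^ Suc N)"
        unfolding eq by simp
      with \<open>x \<le> a ^ Suc N\<close> show ?thesis by presburger
    next
      case False
      \<comment> \<open>All terms summed so far vanish here, so the bound only has to be
        nonnegative.\<close>
      have "0 \<le> r * x - r * (x\<^sup>2 / a ^ Suc N)" if "x \<le> a ^ Suc N"
      proof -
        have "x * x \<le> x * a ^ Suc N" using that assms by (intro mult_left_mono)
        then have "x\<^sup>2 / a ^ Suc N \<le> x"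
          using assms by (simp add: divide_simps power2_eq_square)
        then have "r * (x\<^sup>2 / a ^ Suc N) \<le> r * x" using r by (intro mult_left_mono) auto
        then show ?thesis by linarith
      qed
      then have "0 \<le> (if x \<le> a ^ Suc N then r * x - r * (x\<^sup>2 / a ^ Suc N) else 0)"
        by (simp del: power_Suc)
      moreover have "(\<Sum>n<Suc N. if x \<le> a ^ n then x\<^sup>2 / a ^ n else 0) \<le> 0"
        using False Suc by simp
      ultimately show ?thesis by (rule order_trans[rotated])
    qed
  qed
  also have "\<dots> \<le> r * x"
  proof -
    have "0 \<le> r * (x\<^sup>2 / a ^ N)" "0 \<le> r * x"
      using r assms by (simp_all add: less_imp_le)
    then show ?thesis by simp
  qed
  finally show ?thesis unfolding r_def .
qed

section \<open>From geometric subsequences to the full sequence\<close>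

text \<open>Each \<open>N \<ge> 1\<close> lies between consecutive points of the subsequence with
  ratio \<open>a m\<close>. Monotonicity compares \<open>s N\<close> with the values there, so all
  limit points of \<open>s N / N\<close> lie between \<open>\<mu> / a m\<close> and
  \<open>a m * \<mu>\<close>, for every \<open>m\<close>.\<close>

lemma tendsto_mean_of_geometric_subsequences:
  fixes s :: "nat \<Rightarrow> real"
  assumes mono: "mono s" and nonneg: "\<And>n. 0 \<le> s n" and "0 \<le> \<mu>"
    and sub: "\<And>m. (\<lambda>n. s (nat \<lceil>(1 + 1 / Suc m) ^ n\<rceil>) / nat \<lceil>(1 + 1 / Suc m) ^ n\<rceil>) \<longlonglongrightarrow> \<mu>"
  shows "(\<lambda>n. s n / n) \<longlonglongrightarrow> \<mu>"
proof -
  define a where "a m = 1 + 1 / real (Suc m)" for m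
  define k where "k m n = nat \<lceil>a m ^ n\<rceil>" for m n
  \<comment> \<open>For \<open>N \<ge> 1\<close> this is the exponent of the largest power of
    \<open>a m\<close> not exceeding \<open>N\<close>.\<close>
  define p where "p m N = nat \<lfloor>log (a m) (real N)\<rfloor>" for m N
  have a: "1 < a m" for m by (simp add: a_def)
  have a_lim: "a \<longlonglongrightarrow> 1"
    unfolding a_def by real_asymp
  have sub': "(\<lambda>n. s (k m n) / k m n) \<longlonglongrightarrow> \<mu>" for m
    using sub[of m] by (simp add: k_def a_def)
  have p_lim: "filterlim (p m) at_top sequentially" for m
    unfolding p_def using a[of m]
    by (intro filterlim_compose[OF filterlim_nat_sequentially]
        filterlim_compose[OF filterlim_floor_sequentially]
        filterlim_compose[OF _ filterlim_real_sequentially]) real_asymp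
  have k: "a m ^ n \<le> k m n" "k m n \<le> a m ^ n + 1" for m n
    using a[of m] by (auto simp: k_def of_nat_ceiling)
  have p: "a m ^ p m N \<le> N" "N < a m ^ Suc (p m N)" if "N \<ge> 1" for m N
  proof -
    have "real (p m N) \<le> log (a m) N" "log (a m) N < real (Suc (p m N))"
      using that a[of m] real_of_int_floor_add_one_gt[of "log (a m) N"]
        by (auto simp: p_def zero_le_log_cancel_iff add.commute)
    then show "a m ^ p m N \<le> N" "N < a m ^ Suc (p m N)"
      using that a[of m]
      by (simp_all add: le_log_iff log_less_iff powr_realpow del: power_Suc of_nat_Suc)
  qed
  \<comment> \<open>The term \<open>1 / a m ^ p m N\<close> is the rounding error of the ceiling:
    \<open>k m (Suc n)\<close> is at most \<open>a m ^ Suc n + 1\<close>, divided here by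
    \<open>a m ^ n\<close>.\<close>
  have upper: "s N / N \<le> (a m + 1 / a m ^ p m N) * (s (k m (Suc (p m N))) / k m (Suc (p m N)))"
    if "N \<ge> 1" for m N
  proof -
    let ?n = "p m N"
    have pos: "0 < a m ^ ?n" "0 < a m ^ Suc ?n" using a[of m] by auto
    have "real N < k m (Suc ?n)"
      using p(2)[OF that, of m] k(1)[of m "Suc ?n"] by linarith
    then have "s N \<le> s (k m (Suc ?n))" using mono by (auto simp: mono_def)
    then have "s N / N \<le> s (k m (Suc ?n)) / N" by (intro divide_right_mono) auto
    also have "\<dots> \<le> s (k m (Suc ?n)) / a m ^ ?n"
      using p(1)[OF that, of m] nonneg pos by (intro divide_left_mono) auto
    also have "\<dots> = k m (Suc ?n) / a m ^ ?n * (s (k m (Suc ?n)) / k m (Suc ?n))"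
      using \<open>real N < k m (Suc ?n)\<close> by simp
    also have "\<dots> \<le> (a m + 1 / a m ^ ?n) * (s (k m (Suc ?n)) / k m (Suc ?n))"
      using k(2)[of m "Suc ?n"] pos nonneg by (intro mult_right_mono) (auto simp: field_simps)
    finally show ?thesis .
  qed
  \<comment> \<open>Rounding up now helps: \<open>N < a m ^ Suc n \<le> a m * k m n\<close>, so no
    error term appears.\<close>
  have lower: "1 / a m * (s (k m (p m N)) / k m (p m N)) \<le> s N / N"
    if "N \<ge> 1" for m N
  proof -
    let ?n = "p m N"
    have pos: "0 < a m ^ ?n" "0 < a m" using a[of m] by auto
    then have kpos: "0 < real (k m ?n)" using k(1)[of m ?n] by linarith
    have "a m ^ ?n \<le> real_of_int (int N)" using p(1)[OF that, of m] by simp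
    then have "k m ?n \<le> N" unfolding k_def by (simp add: ceiling_le_iff nat_le_iff)
    then have "s (k m ?n) \<le> s N" using mono by (auto simp: mono_def)
    have "real N \<le> a m * k m ?n"
      using p(2)[OF that, of m] mult_left_mono[OF k(1)[of m ?n] less_imp_le[OF pos(2)]]
      unfolding power_Suc by linarith
    then have "s (k m ?n) / (a m * k m ?n) \<le> s (k m ?n) / N"
      using that nonneg pos kpos by (intro divide_left_mono) auto
    also have "\<dots> \<le> s N / N"
      using \<open>s (k m ?n) \<le> s N\<close> by (intro divide_right_mono) auto
    finally show ?thesis by simp
  qed
  have upper_lim: "(\<lambda>N. (a m + 1 / a m ^ p m N) * (s (k m (Suc (p m N))) / k m (Suc (p m N))))
      \<longlonglongrightarrow> (a m + 0) * \<mu>" for m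
  proof (intro tendsto_mult tendsto_add tendsto_const)
    have "(\<lambda>n. 1 / a m ^ n) \<longlonglongrightarrow> 0" using a[of m] by real_asymp
    then show "(\<lambda>N. 1 / a m ^ p m N) \<longlonglongrightarrow> 0"
      by (rule filterlim_compose[OF _ p_lim])
    show "(\<lambda>N. s (k m (Suc (p m N))) / k m (Suc (p m N))) \<longlonglongrightarrow> \<mu>"
      by (rule filterlim_compose[OF LIMSEQ_Suc[OF sub'] p_lim])
  qed
  have lower_lim: "(\<lambda>N. 1 / a m * (s (k m (p m N)) / k m (p m N))) \<longlonglongrightarrow> 1 / a m * \<mu>" for m
    by (intro tendsto_mult tendsto_const filterlim_compose[OF sub' p_lim])
  show ?thesis
  proof (rule order_tendstoI)
    fix c assume "\<mu> < c"
    have "(\<lambda>m. (a m + 0) * \<mu>) \<longlonglongrightarrow> (1 + 0) * \<mu>"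
      by (intro tendsto_intros a_lim)
    then obtain m where "(a m + 0) * \<mu> < c"
      using order_tendstoD(2)[of _ _ sequentially c] \<open>\<mu> < c\<close>
      by (metis (no_types, lifting) add_0_right eventually_sequentially le_refl mult_1)
    from order_tendstoD(2)[OF upper_lim this] show "\<forall>\<^sub>F n in sequentially. s n / n < c"
      using eventually_ge_at_top[of 1] by eventually_elim (rule le_less_trans[OF upper])
  next
    fix c assume "c < \<mu>"
    have "(\<lambda>m. 1 / a m * \<mu>) \<longlonglongrightarrow> 1 / 1 * \<mu>"
      by (intro tendsto_intros a_lim) simp
    then obtain m where "c < 1 / a m * \<mu>"
      using order_tendstoD(1)[of _ _ sequentially c] \<open>c < \<mu>\<close>
      by (metis (no_types, lifting) div_by_1 eventually_sequentially le_refl mult_1)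
    from order_tendstoD(1)[OF lower_lim this] show "\<forall>\<^sub>F n in sequentially. c < s n / n"
      using eventually_ge_at_top[of 1] by eventually_elim (rule less_le_trans[OF _ lower])
  qed
qed

section \<open>The strong law along one geometric subsequence\<close>

lemma (in prob_space) AE_tendsto_mean_along_powers:
  fixes Z :: "nat \<Rightarrow> 'a \<Rightarrow> real" and a :: real
  assumes indep: "\<And>i j. i \<noteq> j \<Longrightarrow> indep_var borel (Z i) borel (Z j)"
    and ident: "\<And>i. distr M borel (Z i) = distr M borel (Z 0)"
    and int: "integrable M (Z 0)"
    and nonneg: "\<And>i x. 0 \<le> Z i x"
    and a: "1 < a"
  shows "AE x in M. (\<lambda>n. (\<Sum>i<nat \<lceil>a ^ n\<rceil>. Z i x) / nat \<lceil>a ^ n\<rceil>) \<longlonglongrightarrow> expectation (Z 0)"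
proof -
  define k where "k n = nat \<lceil>a ^ n\<rceil>" for n
  \<comment> \<open>The level depends on the block \<open>n\<close> and not on the index of the
    variable, so the truncated variables within a block are again identically distributed.\<close>
  define g where "g n z = (if z \<le> a ^ n then z else 0)" for n and z :: real
  define T where "T n x = (\<Sum>i<k n. g n (Z i x))" for n x
  define m where "m n = expectation (\<lambda>x. g n (Z 0 x))" for n
  have [measurable]: "g n \<in> borel_measurable borel" for n
    unfolding g_def by measurable
  have rv[measurable]: "Z i \<in> borel_measurable M" for i
    using indep_var_rv1[OF indep[of i "Suc i"]] by simp
  have [measurable]: "T n \<in> borel_measurable M" for n
    unfolding T_def by measurable
  have a_ge: "1 \<le> a ^ n" for n using a by simp
  have k: "a ^ n \<le> k n" "k n \<le> 2 * a ^ n" "0 < real (k n)" for n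
  proof -
    show "a ^ n \<le> k n" unfolding k_def by (rule real_nat_ceiling_ge)
    with a_ge[of n] show "0 < real (k n)" by linarith
    have "k n \<le> a ^ n + 1" using a by (simp add: k_def of_nat_ceiling)
    with a_ge[of n] show "k n \<le> 2 * a ^ n" by linarith
  qed
  have E_ident: "expectation (\<lambda>x. h (Z i x)) = expectation (\<lambda>x. h (Z 0 x))"
    if [measurable]: "h \<in> borel_measurable borel" for h :: "real \<Rightarrow> real" and i
  proof -
    have "expectation (\<lambda>x. h (Z i x)) = integral\<^sup>L (distr M borel (Z i)) h"
      by (rule integral_distr[symmetric]) measurable
    also have "\<dots> = expectation (\<lambda>x. h (Z 0 x))"
      unfolding ident[of i] by (rule integral_distr) measurable
    finally show ?thesis .
  qed
  have g_bound: "0 \<le> g n (Z i x)" "g n (Z i x) \<le> a ^ n" for n i x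
    using nonneg a by (auto simp: g_def)
  have int_g: "integrable M (\<lambda>x. g n (Z i x))" for n i
    using g_bound by (intro integrable_const_bound[of _ "a ^ n"]) auto
  have int_g2: "integrable M (\<lambda>x. (g n (Z i x))\<^sup>2)" for n i
    using g_bound by (intro integrable_const_bound[of _ "(a ^ n)\<^sup>2"]) (auto intro!: AE_I2 power_mono)
  have indep_g: "indep_var borel (\<lambda>x. g n (Z i x)) borel (\<lambda>x. g n (Z j x))" if "i \<noteq> j" for n i j
    using indep_var_compose[OF indep[OF that], of "g n" borel "g n" borel] by (simp add: comp_def)
  have E_T: "expectation (T n) = k n * m n" for n
  proof -
    have "expectation (T n) = (\<Sum>i<k n. expectation (\<lambda>x. g n (Z i x)))"
      unfolding T_def by (intro Bochner_Integration.integral_sum int_g)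
    also have "\<dots> = (\<Sum>i<k n. m n)"
      unfolding m_def by (intro sum.cong refl E_ident) measurable
    finally show ?thesis by simp
  qed
  have T2: "integrable M (\<lambda>x. (T n x)\<^sup>2)" for n
    unfolding T_def by (intro variance_sum_pairwise_indep int_g int_g2 indep_g) auto
  have var_T: "variance (T n) \<le> k n * expectation (\<lambda>x. (g n (Z 0 x))\<^sup>2)" for n
  proof -
    have "variance (T n) = (\<Sum>i<k n. variance (\<lambda>x. g n (Z i x)))"
      unfolding T_def by (intro variance_sum_pairwise_indep int_g int_g2 indep_g) auto
    also have "\<dots> \<le> (\<Sum>i<k n. expectation (\<lambda>x. (g n (Z i x))\<^sup>2))"
      by (intro sum_mono, subst variance_eq[OF int_g int_g2]) simp
    also have "\<dots> = (\<Sum>i<k n. expectation (\<lambda>x. (g n (Z 0 x))\<^sup>2))"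
      by (intro sum.cong refl E_ident[of "\<lambda>z. (g n z)\<^sup>2"]) measurable
    finally show ?thesis by simp
  qed

  \<comment> \<open>Outside \<open>A n\<close> truncation changes none of the first
    \<open>k n\<close> variables. The union bound costs a factor \<open>k n \<le> 2 * a ^ n\<close>,
    which produces the summands of \<open>sum_powers_below\<close>.\<close>
  define A where "A n = (\<Union>i<k n. {x \<in> space M. a ^ n < Z i x})" for n
  have [measurable]: "A n \<in> events" for n unfolding A_def by measurable
  have int_above: "integrable M (\<lambda>x. if a ^ n < Z 0 x then a ^ n else 0)" for n
    using a_ge[of n] by (intro integrable_const_bound[of _ "a ^ n"]) auto
  have prob_A: "prob (A n) \<le> 2 * expectation (\<lambda>x. if a ^ n < Z 0 x then a ^ n else 0)" for n
  proof -
    have indicator: "prob {x \<in> space M. a ^ n < Z i x} =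
        expectation (\<lambda>x. indicat_real {a ^ n<..} (Z i x))" for i
    proof -
      have "expectation (\<lambda>x. indicat_real {a ^ n<..} (Z i x)) =
          expectation (indicat_real {x \<in> space M. a ^ n < Z i x})"
        by (intro Bochner_Integration.integral_cong) (auto simp: indicator_def)
      then show ?thesis by simp
    qed
    have "prob (A n) \<le> (\<Sum>i<k n. prob {x \<in> space M. a ^ n < Z i x})"
      unfolding A_def by (intro finite_measure_subadditive_finite) auto
    also have "\<dots> = (\<Sum>i<k n. expectation (\<lambda>x. indicat_real {a ^ n<..} (Z 0 x)))"
      unfolding indicator by (intro sum.cong refl E_ident) measurable
    also have "\<dots> = k n * expectation (\<lambda>x. indicat_real {a ^ n<..} (Z 0 x))"
      by simp
    also have "\<dots> \<le> (2 * a ^ n) * expectation (\<lambda>x. indicat_real {a ^ n<..} (Z 0 x))"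
      using k(2)[of n] by (intro mult_right_mono) auto
    also have "\<dots> = 2 * expectation (\<lambda>x. a ^ n * indicator {a ^ n<..} (Z 0 x))"
      by simp
    also have "(\<lambda>x. a ^ n * indicator {a ^ n<..} (Z 0 x)) = (\<lambda>x. if a ^ n < Z 0 x then a ^ n else 0)"
      by (auto simp: indicator_def)
    finally show ?thesis .
  qed
  \<comment> \<open>Only finite sums are exchanged with the expectation; the resulting bound does
    not depend on \<open>N\<close>.\<close>
  have sum_A: "summable (\<lambda>n. prob (A n))"
  proof (rule summableI_nonneg_bounded)
    fix N
    have "(\<Sum>n<N. prob (A n)) \<le> (\<Sum>n<N. 2 * expectation (\<lambda>x. if a ^ n < Z 0 x then a ^ n else 0))"
      by (intro sum_mono prob_A)
    also have "\<dots> = 2 * expectation (\<lambda>x. \<Sum>n<N. if a ^ n < Z 0 x then a ^ n else 0)"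
      using int_above by (subst Bochner_Integration.integral_sum) (auto simp: sum_distrib_left)
    also have "\<dots> \<le> 2 * expectation (\<lambda>x. a / (a - 1) * Z 0 x)"
      using int int_above sum_powers_below[OF a nonneg]
      by (intro mult_left_mono integral_mono Bochner_Integration.integrable_sum) auto
    finally show "(\<Sum>n<N. prob (A n)) \<le> 2 * expectation (\<lambda>x. a / (a - 1) * Z 0 x)" .
  qed simp
  have AE_A: "AE x in M. eventually (\<lambda>n. x \<in> space M - A n) sequentially"
    by (intro borel_cantelli_AE1 sum_A) (auto simp: less_top[symmetric])

  \<comment> \<open>In Chebyshev's inequality a variance of order \<open>k n\<close> meets
    \<open>(k n)\<^sup>2\<close>. The remaining \<open>1 / k n\<close> is at most
    \<open>1 / a ^ n\<close>, which gives the summands of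
    \<open>sum_inverse_powers_above\<close>.\<close>
  define B where "B e n = {x \<in> space M. e * k n \<le> \<bar>T n x - expectation (T n)\<bar>}" for e :: real and n
  have [measurable]: "B e n \<in> events" for e n unfolding B_def by measurable
  \<comment> \<open>The integrand is \<open>(g n (Z 0 x))\<^sup>2 / a ^ n\<close> written
    out.\<close>
  have int_below: "integrable M (\<lambda>x. if Z 0 x \<le> a ^ n then (Z 0 x)\<^sup>2 / a ^ n else 0)" for n
    using integrable_divide_zero[OF int_g2[of n 0], of "a ^ n"]
    by (rule Bochner_Integration.integrable_cong[THEN iffD1, rotated -1]) (auto simp: g_def)
  have prob_B: "prob (B e n) \<le>
      1 / e\<^sup>2 * expectation (\<lambda>x. if Z 0 x \<le> a ^ n then (Z 0 x)\<^sup>2 / a ^ n else 0)" if "0 < e" for e n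
  proof -
    let ?E = "expectation (\<lambda>x. (g n (Z 0 x))\<^sup>2)"
    have E: "0 \<le> ?E" by simp
    have "prob (B e n) \<le> variance (T n) / (e * k n)\<^sup>2"
      unfolding B_def using that k(3)[of n] T2 by (intro Chebyshev_inequality) auto
    also have "\<dots> \<le> (k n * ?E) / (e * k n)\<^sup>2"
      by (intro divide_right_mono var_T) simp
    also have "\<dots> = ?E / (e\<^sup>2 * k n)"
      using k(3)[of n] that by (simp add: power2_eq_square)
    also have "\<dots> \<le> ?E / (e\<^sup>2 * a ^ n)"
      using k[of n] a_ge[of n] that E by (intro divide_left_mono mult_left_mono mult_pos_pos) auto
    also have "\<dots> = 1 / e\<^sup>2 * expectation (\<lambda>x. (g n (Z 0 x))\<^sup>2 / a ^ n)"
      by simp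
    also have "(\<lambda>x. (g n (Z 0 x))\<^sup>2 / a ^ n) = (\<lambda>x. if Z 0 x \<le> a ^ n then (Z 0 x)\<^sup>2 / a ^ n else 0)"
      by (auto simp: g_def)
    finally show ?thesis .
  qed
  have sum_B: "summable (\<lambda>n. prob (B e n))" if "0 < e" for e
  proof (rule summableI_nonneg_bounded)
    fix N
    have "(\<Sum>n<N. prob (B e n)) \<le>
        (\<Sum>n<N. 1 / e\<^sup>2 * expectation (\<lambda>x. if Z 0 x \<le> a ^ n then (Z 0 x)\<^sup>2 / a ^ n else 0))"
      using that by (intro sum_mono prob_B)
    also have "\<dots> = 1 / e\<^sup>2 * expectation (\<lambda>x. \<Sum>n<N. if Z 0 x \<le> a ^ n then (Z 0 x)\<^sup>2 / a ^ n else 0)"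
      using int_below by (subst Bochner_Integration.integral_sum) (auto simp: sum_distrib_left)
    also have "\<dots> \<le> 1 / e\<^sup>2 * expectation (\<lambda>x. a / (a - 1) * Z 0 x)"
      using int int_below sum_inverse_powers_above[OF a nonneg]
      by (intro mult_left_mono integral_mono Bochner_Integration.integrable_sum) auto
    finally show "(\<Sum>n<N. prob (B e n)) \<le> 1 / e\<^sup>2 * expectation (\<lambda>x. a / (a - 1) * Z 0 x)" .
  qed simp
  \<comment> \<open>Countably many tolerances \<open>1 / Suc p\<close> allow a single null
    set.\<close>
  have AE_B: "AE x in M. \<forall>p. eventually (\<lambda>n. x \<in> space M - B (1 / Suc p) n) sequentially"
    unfolding AE_all_countable
    by (intro allI borel_cantelli_AE1 sum_B) (auto simp: less_top[symmetric])

  have m_lim: "m \<longlonglongrightarrow> expectation (Z 0)"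
    unfolding m_def
  proof (rule integral_dominated_convergence[where w = "Z 0"])
    show "AE x in M. (\<lambda>n. g n (Z 0 x)) \<longlonglongrightarrow> Z 0 x"
    proof (rule AE_I2)
      fix x
      have "eventually (\<lambda>n. Z 0 x \<le> a ^ n) sequentially"
        using a by real_asymp
      then show "(\<lambda>n. g n (Z 0 x)) \<longlonglongrightarrow> Z 0 x"
        by (intro tendsto_eventually, elim eventually_mono) (simp add: g_def)
    qed
  qed (use int nonneg in \<open>auto simp: g_def\<close>)

  from AE_A AE_B show ?thesis
  proof eventually_elim
    case (elim x)
    have "(\<lambda>n. T n x / k n - m n) \<longlonglongrightarrow> 0"
    proof (rule LIMSEQ_I)
      fix e :: real assume "0 < e"
      then obtain p where p: "1 / real (Suc p) < e"
        using nat_approx_posE by blast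
      from elim(2) have "eventually (\<lambda>n. x \<in> space M - B (1 / Suc p) n) sequentially" ..
      then have "eventually (\<lambda>n. norm (T n x / k n - m n - 0) < e) sequentially"
      proof eventually_elim
        case (elim n)
        then have "\<bar>T n x - k n * m n\<bar> < 1 / Suc p * k n"
          by (auto simp: B_def E_T)
        moreover have "T n x / k n - m n = (T n x - k n * m n) / k n"
          using k(3)[of n] by (simp add: diff_divide_distrib)
        ultimately have "\<bar>T n x / k n - m n\<bar> < 1 / Suc p"
          using k(3)[of n] by (simp only: abs_divide abs_of_nat pos_divide_less_eq)
        with p show ?case by simp
      qed
      then show "\<exists>no. \<forall>n\<ge>no. norm (T n x / k n - m n - 0) < e"
        by (simp add: eventually_sequentially)
    qed
    from tendsto_add[OF this m_lim] have "(\<lambda>n. T n x / k n) \<longlonglongrightarrow> expectation (Z 0)"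
      by simp
    moreover from elim(1) have "eventually (\<lambda>n. T n x / k n = (\<Sum>i<k n. Z i x) / k n) sequentially"
    proof eventually_elim
      case (elim n)
      then have "g n (Z i x) = Z i x" if "i < k n" for i
        using that by (auto simp: A_def g_def not_less)
      then show ?case by (simp add: T_def)
    qed
    ultimately show ?case
      unfolding k_def[symmetric] by (rule Lim_transform_eventually)
  qed
qed

section \<open>The strong law for the full sequence, and for functions of a sample\<close>

lemma (in prob_space) indep_vars_imp_indep_var:
  assumes "indep_vars N X I" "i \<in> I" "j \<in> I" "i \<noteq> j"
  shows "indep_var (N i) (X i) (N j) (X j)"
proof -
  have "indep_var (N i) ((\<lambda>f. f i) \<circ> (\<lambda>x. restrict (\<lambda>l. X l x) {i}))
      (N j) ((\<lambda>f. f j) \<circ> (\<lambda>x. restrict (\<lambda>l. X l x) {j}))"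
    using assms by (intro indep_var_compose[OF indep_var_restrict[OF assms(1)]] measurable_component_singleton) auto
  then show ?thesis by (simp add: comp_def)
qed

text \<open>The ratios \<open>1 + 1 / Suc m\<close> are countably many, so their null sets can be
  united before the deterministic comparison is applied pointwise.\<close>

lemma (in prob_space) strong_law_of_large_numbers_nonneg:
  fixes Z :: "nat \<Rightarrow> 'a \<Rightarrow> real"
  assumes indep: "\<And>i j. i \<noteq> j \<Longrightarrow> indep_var borel (Z i) borel (Z j)"
    and ident: "\<And>i. distr M borel (Z i) = distr M borel (Z 0)"
    and int: "integrable M (Z 0)"
    and nonneg: "\<And>i x. 0 \<le> Z i x"
  shows "AE x in M. (\<lambda>n. (\<Sum>i<n. Z i x) / n) \<longlonglongrightarrow> expectation (Z 0)"
proof -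
  have "AE x in M. \<forall>m. (\<lambda>n. (\<Sum>i<nat \<lceil>(1 + 1 / Suc m) ^ n\<rceil>. Z i x) / nat \<lceil>(1 + 1 / Suc m) ^ n\<rceil>)
      \<longlonglongrightarrow> expectation (Z 0)"
    unfolding AE_all_countable
    by (intro allI AE_tendsto_mean_along_powers assms) simp_all
  then show ?thesis
  proof eventually_elim
    case (elim x)
    have "0 \<le> expectation (Z 0)" using nonneg by simp
    moreover have "mono (\<lambda>n. \<Sum>i<n. Z i x)"
      using nonneg by (intro monoI sum_mono2) auto
    ultimately show ?case
      using elim nonneg by (intro tendsto_mean_of_geometric_subsequences sum_nonneg) auto
  qed
qed

theorem (in prob_space) strong_law_of_large_numbers:
  fixes Z :: "nat \<Rightarrow> 'a \<Rightarrow> real"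
  assumes indep: "\<And>i j. i \<noteq> j \<Longrightarrow> indep_var borel (Z i) borel (Z j)"
    and ident: "\<And>i. distr M borel (Z i) = distr M borel (Z 0)"
    and int: "integrable M (Z 0)"
  shows "AE x in M. (\<lambda>n. (\<Sum>i<n. Z i x) / n) \<longlonglongrightarrow> expectation (Z 0)"
proof -
  have rv[measurable]: "Z i \<in> borel_measurable M" for i
    using indep_var_rv1[OF indep[of i "Suc i"]] by simp
  \<comment> \<open>The values \<open>c = 1\<close> and \<open>c = -1\<close> give the positive and
    the negative part.\<close>
  have part: "AE x in M. (\<lambda>n. (\<Sum>i<n. max 0 (c * Z i x)) / n) \<longlonglongrightarrow> expectation (\<lambda>x. max 0 (c * Z 0 x))"
    for c
  proof (rule strong_law_of_large_numbers_nonneg)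
    fix i j :: nat
    assume "i \<noteq> j"
    from indep_var_compose[OF indep[OF this], of "\<lambda>z. max 0 (c * z)" borel "\<lambda>z. max 0 (c * z)" borel]
    show "indep_var borel (\<lambda>x. max 0 (c * Z i x)) borel (\<lambda>x. max 0 (c * Z j x))"
      by (simp add: comp_def)
  next
    fix i
    have "distr M borel (\<lambda>x. max 0 (c * Z i x)) = distr (distr M borel (Z i)) borel (\<lambda>z. max 0 (c * z))" for i
      by (subst distr_distr) (auto simp: comp_def)
    then show "distr M borel (\<lambda>x. max 0 (c * Z i x)) = distr M borel (\<lambda>x. max 0 (c * Z 0 x))"
      using ident[of i] by simp
  qed (use int in auto)
  have split: "z = max 0 (1 * z) - max 0 (- 1 * z)" for z :: real
    by (simp add: max_def)
  have E: "expectation (Z 0) = expectation (\<lambda>x. max 0 (1 * Z 0 x)) - expectation (\<lambda>x. max 0 (- 1 * Z 0 x))"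
    by (subst Bochner_Integration.integral_diff[symmetric]) (use int split in auto)
  from part[of 1] part[of "-1"] show ?thesis
  proof eventually_elim
    case (elim x)
    have "(\<Sum>i<n. Z i x) = (\<Sum>i<n. max 0 (1 * Z i x)) - (\<Sum>i<n. max 0 (- 1 * Z i x))" for n
      unfolding sum_subtractf[symmetric] by (intro sum.cong refl split)
    with tendsto_diff[OF elim] show ?case
      by (simp only: E diff_divide_distrib)
  qed
qed

text \<open>The sample lives on \<open>M\<close> and the model variable on \<open>N\<close>, so
  integrability and the value of the limit are transferred through the common law of
  \<open>h (X i)\<close> and \<open>h Y\<close>. The sample is numbered from 1, hence the shift by
  \<open>Suc\<close>.\<close>

lemma (in prob_space) strong_law_of_large_numbers_comp:
  fixes X :: "nat \<Rightarrow> 'a \<Rightarrow> 'c::topological_space" and h :: "'c \<Rightarrow> real"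
  assumes indep: "indep_vars (\<lambda>_. borel) X {1..}"
    and ident: "\<And>i. i \<ge> 1 \<Longrightarrow> distr M borel (X i) = distr N borel Y"
    and Y [measurable]: "Y \<in> N \<rightarrow>\<^sub>M borel"
    and h [measurable]: "h \<in> borel_measurable borel"
    and int: "integrable N (\<lambda>x. h (Y x))"
  shows "AE x in M. (\<lambda>n. (\<Sum>i=1..n. h (X i x)) / n) \<longlonglongrightarrow> integral\<^sup>L N (\<lambda>x. h (Y x))"
proof -
  have rv [measurable]: "X (Suc i) \<in> M \<rightarrow>\<^sub>M borel" for i
    using indep by (auto simp: indep_vars_def2)
  have dist: "distr M borel (\<lambda>x. h (X (Suc i) x)) = distr N borel (\<lambda>x. h (Y x))" for i
  proof -
    have "distr M borel (\<lambda>x. h (X (Suc i) x)) = distr (distr M borel (X (Suc i))) borel h"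
      by (subst distr_distr) (auto simp: comp_def)
    also have "\<dots> = distr (distr N borel Y) borel h" by (simp add: ident)
    also have "\<dots> = distr N borel (\<lambda>x. h (Y x))"
      by (subst distr_distr) (auto simp: comp_def)
    finally show ?thesis .
  qed
  have "AE x in M. (\<lambda>n. (\<Sum>i<n. h (X (Suc i) x)) / n) \<longlonglongrightarrow> expectation (\<lambda>x. h (X (Suc 0) x))"
  proof (rule strong_law_of_large_numbers)
    fix i j :: nat
    assume "i \<noteq> j"
    then have "indep_var borel (X (Suc i)) borel (X (Suc j))"
      by (intro indep_vars_imp_indep_var[OF indep]) auto
    from indep_var_compose[OF this h h]
    show "indep_var borel (\<lambda>x. h (X (Suc i) x)) borel (\<lambda>x. h (X (Suc j) x))"
      by (simp add: comp_def)
  next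
    have "integrable (distr M borel (\<lambda>x. h (X (Suc 0) x))) (\<lambda>z. z)"
      unfolding dist using int by (subst integrable_distr_eq) auto
    then show "integrable M (\<lambda>x. h (X (Suc 0) x))"
      by (subst (asm) integrable_distr_eq) auto
  qed (simp only: dist)
  moreover have "expectation (\<lambda>x. h (X (Suc 0) x)) = integral\<^sup>L N (\<lambda>x. h (Y x))"
  proof -
    have "expectation (\<lambda>x. h (X (Suc 0) x)) = integral\<^sup>L (distr M borel (\<lambda>x. h (X (Suc 0) x))) (\<lambda>z. z)"
      by (subst integral_distr) auto
    also have "\<dots> = integral\<^sup>L N (\<lambda>x. h (Y x))"
      unfolding dist by (subst integral_distr) auto
    finally show ?thesis .
  qed
  moreover have "(\<Sum>i=1..n. f i) = (\<Sum>i<n. f (Suc i))" for n and f :: "nat \<Rightarrow> real"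
    by (simp add: sum.atLeast1_atMost_eq)
  ultimately show ?thesis by simp
qed

section \<open>Limits of the sample mean and the sample covariance\<close>

lemma tendsto_sample_mean:
  assumes "\<And>l. (\<lambda>n. (\<Sum>i=1..n. y i $ l) / n) \<longlonglongrightarrow> m $ l"
  shows "(\<lambda>n. sample_mean n y) \<longlonglongrightarrow> m"
  using assms by (intro vec_tendstoI) (simp add: sample_mean_def)

text \<open>The factor \<open>1 / (n - 1)\<close> on the sum of products is
  \<open>n / (n - 1)\<close> times the averaging factor \<open>1 / n\<close>, and
  \<open>n / (n - 1)\<close> tends to 1.\<close>

lemma tendsto_sample_cov:
  assumes mean: "\<And>l. (\<lambda>n. (\<Sum>i=1..n. y i $ l) / n) \<longlonglongrightarrow> m $ l"
    and prod: "\<And>l1 l2. (\<lambda>n. (\<Sum>i=1..n. y i $ l1 * y i $ l2) / n) \<longlonglongrightarrow> S $ l1 $ l2"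
  shows "(\<lambda>n. sample_cov n y) \<longlonglongrightarrow> S - outer_product m m"
proof (intro vec_tendstoI)
  fix l1 l2
  have "(\<lambda>n. n / (real n - 1) * ((\<Sum>i=1..n. y i $ l1 * y i $ l2) / n)
      - sample_mean n y $ l1 * sample_mean n y $ l2) \<longlonglongrightarrow> 1 * S $ l1 $ l2 - m $ l1 * m $ l2"
    by (intro tendsto_diff tendsto_mult prod tendsto_vec_nth tendsto_sample_mean mean) real_asymp
  \<comment> \<open>At \<open>n = 1\<close> division by zero makes both first summands 0, so the
    identity holds there too.\<close>
  moreover have "eventually (\<lambda>n. n / (real n - 1) * ((\<Sum>i=1..n. y i $ l1 * y i $ l2) / n)
      - sample_mean n y $ l1 * sample_mean n y $ l2 = sample_cov n y $ l1 $ l2) sequentially"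
    using eventually_ge_at_top[of 1]
    by eventually_elim (simp add: sample_cov_def outer_product_def)
  ultimately show "(\<lambda>n. sample_cov n y $ l1 $ l2) \<longlonglongrightarrow> (S - outer_product m m) $ l1 $ l2"
    by (simp add: outer_product_def tendsto_cong)
qed

lemma tendsto_matrix_vector_mult:
  fixes A :: "'b \<Rightarrow> real ^ 'n ^ 'm"
  assumes "(A \<longlongrightarrow> A') F" "(v \<longlongrightarrow> v') F"
  shows "((\<lambda>x. A x *v v x) \<longlongrightarrow> A' *v v') F"
  unfolding matrix_vector_mult_def
  by (intro tendsto_vec_lambda tendsto_sum tendsto_mult tendsto_vec_nth assms)

lemma tendsto_diag_matrix:
  assumes "(v \<longlongrightarrow> v') F"
  shows "((\<lambda>x. diag_matrix (v x)) \<longlongrightarrow> diag_matrix v') F"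
  unfolding diag_matrix_def
  by (intro tendsto_vec_lambda) (auto intro: tendsto_vec_nth assms)

section \<open>Strong consistency of both empirical indexes\<close>

theorem proposition3:
  fixes N :: "'b measure" and Y :: "'b \<Rightarrow> real ^ 'k" and f :: "real ^ 'k \<Rightarrow> ennreal"
    and M :: "'a measure" and X :: "nat \<Rightarrow> 'a \<Rightarrow> real ^ 'k"
  assumes "prob_space N"
    and continuous: "distributed N lborel Y f"
    and positive: "AE \<omega> in N. \<forall>l. 0 < Y \<omega> $ l"
    and moments: "\<And>l1 l2. integrable N (\<lambda>\<omega>. Y \<omega> $ l1 * Y \<omega> $ l2)"
    and "prob_space M"
    and indep: "prob_space.indep_vars M (\<lambda>_. borel) X {1..}"
    and ident: "\<And>i. i \<ge> 1 \<Longrightarrow> distr M borel (X i) = distr N borel Y"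
  shows "(AE \<omega> in M. (\<lambda>n. empirical_GVI n (\<lambda>i. X i \<omega>)) \<longlonglongrightarrow> GVI N Y) \<and>
    (AE \<omega> in M. (\<lambda>n. empirical_MVI n (\<lambda>i. X i \<omega>)) \<longlonglongrightarrow> MVI N Y)"
proof -
  interpret N: prob_space N by fact
  interpret M: prob_space M by fact
  have Y [measurable]: "Y \<in> borel_measurable N"
    using distributed_measurable[OF continuous] by simp
  have nth [measurable]: "(\<lambda>v::real ^ 'k. v $ l) \<in> borel_measurable borel" for l
    by (intro borel_measurable_continuous_onI continuous_intros)
  have Y_nth [measurable]: "(\<lambda>\<omega>. Y \<omega> $ l) \<in> borel_measurable N" for l
    by (rule measurable_compose[OF Y nth])
  have int1: "integrable N (\<lambda>\<omega>. Y \<omega> $ l)" for l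
    using N.square_integrable_imp_integrable[OF Y_nth] moments[of l l]
    by (simp add: power2_eq_square)
  \<comment> \<open>The indexes use the vector-valued integral of \<open>Y\<close>. Its existence
    follows by comparison with the l1 norm, and it is then computed coordinatewise.\<close>
  have intY: "integrable N Y"
  proof (rule Bochner_Integration.integrable_bound)
    show "integrable N (\<lambda>\<omega>. \<Sum>l\<in>UNIV. \<bar>Y \<omega> $ l\<bar>)"
      using int1 by auto
    show "AE \<omega> in N. norm (Y \<omega>) \<le> norm (\<Sum>l\<in>UNIV. \<bar>Y \<omega> $ l\<bar>)"
      using norm_le_l1_cart by (auto simp: sum_nonneg)
  qed simp
  define m where "m = N.expectation Y"
  define S where "S = (\<chi> l1 l2. N.expectation (\<lambda>\<omega>. Y \<omega> $ l1 * Y \<omega> $ l2))"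
  have m: "N.expectation (\<lambda>\<omega>. Y \<omega> $ l) = m $ l" for l
    unfolding m_def by (rule integral_bounded_linear[OF bounded_linear_vec_nth intY])
  have cov: "cov_matrix N Y = S - outer_product m m"
  proof -
    have "N.expectation (\<lambda>\<omega>. (Y \<omega> $ i - m $ i) * (Y \<omega> $ j - m $ j)) = S $ i $ j - m $ i * m $ j" for i j
    proof -
      have "(\<lambda>\<omega>. (Y \<omega> $ i - m $ i) * (Y \<omega> $ j - m $ j)) =
          (\<lambda>\<omega>. Y \<omega> $ i * Y \<omega> $ j - m $ j * Y \<omega> $ i - m $ i * Y \<omega> $ j + m $ i * m $ j)"
        by (simp add: algebra_simps)
      then show ?thesis
        using int1 moments by (simp add: S_def m N.prob_space)
    qed
    then show ?thesis by (simp add: cov_matrix_def outer_product_def m vec_eq_iff)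
  qed
  \<comment> \<open>This makes the limit of the sample covariance serve for \<open>MVI\<close> as
    well.\<close>
  have var: "var_vector N Y = (\<chi> l. cov_matrix N Y $ l $ l)"
    by (simp add: var_vector_def cov_matrix_def power2_eq_square)
  \<comment> \<open>Positivity of \<open>Y\<close> makes every coordinate of the mean strictly
    positive, and the index type is nonempty, so the limiting denominator does not vanish.\<close>
  have m_nonzero: "(m \<bullet> m)\<^sup>2 \<noteq> 0"
  proof -
    have "0 < N.expectation (\<lambda>\<omega>. Y \<omega> $ l)" for l
      using positive int1 by (intro N.expectation_greater) auto
    then have "m $ l \<noteq> 0" for l unfolding m by (simp add: less_imp_neq[symmetric])
    then have "m \<noteq> 0" by auto
    then show ?thesis by simp
  qed
  have "AE \<omega> in M. (\<lambda>n. (\<Sum>i=1..n. X i \<omega> $ l) / n) \<longlonglongrightarrow> m $ l" for l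
    using M.strong_law_of_large_numbers_comp[OF indep ident Y, of "\<lambda>v. v $ l"] int1[of l]
    by (simp add: m)
  \<comment> \<open>There are finitely many coordinates, so one null set serves them all.\<close>
  then have mean: "AE \<omega> in M. \<forall>l. (\<lambda>n. (\<Sum>i=1..n. X i \<omega> $ l) / n) \<longlonglongrightarrow> m $ l"
    by (simp add: AE_all_countable)
  have "AE \<omega> in M. (\<lambda>n. (\<Sum>i=1..n. X i \<omega> $ l1 * X i \<omega> $ l2) / n) \<longlonglongrightarrow> S $ l1 $ l2" for l1 l2
    using M.strong_law_of_large_numbers_comp[OF indep ident Y, of "\<lambda>v. v $ l1 * v $ l2"] moments[of l1 l2]
    by (simp add: S_def)
  then have prod: "AE \<omega> in M. \<forall>l1 l2. (\<lambda>n. (\<Sum>i=1..n. X i \<omega> $ l1 * X i \<omega> $ l2) / n) \<longlonglongrightarrow> S $ l1 $ l2"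
    by (simp add: AE_all_countable)
  from mean prod have lim: "AE \<omega> in M. (\<lambda>n. sample_mean n (\<lambda>i. X i \<omega>)) \<longlonglongrightarrow> m \<and>
      (\<lambda>n. sample_cov n (\<lambda>i. X i \<omega>)) \<longlonglongrightarrow> cov_matrix N Y"
    unfolding cov by eventually_elim (simp add: tendsto_sample_mean tendsto_sample_cov)
  show ?thesis
  proof
    from lim show "AE \<omega> in M. (\<lambda>n. empirical_GVI n (\<lambda>i. X i \<omega>)) \<longlonglongrightarrow> GVI N Y"
    proof eventually_elim
      case (elim \<omega>)
      then show ?case
        unfolding empirical_GVI_def GVI_def Let_def m_def[symmetric]
        by (intro tendsto_divide tendsto_power tendsto_inner tendsto_matrix_vector_mult m_nonzero) auto
    qed
    from lim show "AE \<omega> in M. (\<lambda>n. empirical_MVI n (\<lambda>i. X i \<omega>)) \<longlonglongrightarrow> MVI N Y"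
    proof eventually_elim
      case (elim \<omega>)
      then show ?case
        unfolding empirical_MVI_def MVI_def Let_def m_def[symmetric] var
        by (intro tendsto_divide tendsto_power tendsto_inner tendsto_matrix_vector_mult
            tendsto_diag_matrix tendsto_vec_lambda tendsto_vec_nth m_nonzero) auto
    qed
  qed
qed

end
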